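(* Let $m \ge 1$, let $B = [g_1, h_1] \times \cdots \times [g_m, h_m]$ be an interval (box) in $\mathbb{R}^m$, and consider the mixed type Volterra-Fredholm functional nonlinear integral equation $$x(t) = F\left(t, x(t), \int_{g_1}^{t_1} \cdots \int_{g_m}^{t_m} K(t, s, x(s))\, ds, \int_{g_1}^{h_1} \cdots \int_{g_m}^{h_m} H(t, s, x(s))\, ds\right), \qquad t = (t_1, \dots, t_m) \in B. \quad ( * )$$ Suppose that: $(A_1)$ $K, H \in C(B \times B \times \mathbb{R})$ (real-valued); $(A_2)$ $F \in C(B \times \mathbb{R}^3)$ (real-valued); $(A_3)$ there exist nonnegative constants $\alpha, \beta, \gamma$ such that $|F(t, u_1, v_1, w_1) - F(t, u_2, v_2, w_2)| \le \alpha |u_1 - u_2| + \beta |v_1 - v_2| + \gamma |w_1 - w_2|$ for all $t \in B$ and $u_i, v_i, w_i \in \mathbb{R}$, $i = 1, 2$; $(A_4)$ there exist nonnegative constants $L_K$ and $L_H$ such that $|K(t,s,u) - K(t,s,v)| \le L_K |u - v|$ and $|H(t,s,u) - H(t,s,v)| \le L_H |u - v|$ for all $t, s \in B$ and $u, v \in \mathbb{R}$; $(A_5)$ $\alpha + (\beta L_K + \gamma L_H)(h_1 - g_1) \cdots (h_m - g_m) < 1$. Let $\{\delta_n\}_{n \ge 1} \subset [0,1]$ be a real sequence satisfying $\sum_{n=1}^{\infty} \delta_n = \infty$. Let $G = C(B)$ with the Chebyshev norm, and let $A: G \to G$ be the operator $$A(c)(t) = F\left(t, c(t), \int_{g_1}^{t_1}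 \cdots \int_{g_m}^{t_m} K(t, s, c(s))\, ds, \int_{g_1}^{h_1} \cdots \int_{g_m}^{h_m} H(t, s, c(s))\, ds\right).$$ Then $( * )$ has a unique solution $p \in C(B)$, and the sequence $\{c_n\}$ generated from an arbitrary $c_1 \in G$ by $$a_n = A c_n, \qquad b_n = (1-\delta_n) a_n + \delta_n A a_n, \qquad c_{n+1} = A b_n \qquad (n \in \mathbb{N})$$ converges to $p$ in $G$.
   Context: $C(X)$ denotes the space of continuous real-valued functions on $X$. The Chebyshev norm on $C(B)$ is the supremum norm $\|x\|_C = \sup_{t \in B} |x(t)|$. *)

theory Defs
  imports "HOL-Analysis.Analysis" "HOL-Library.FuncSet"
begin

(* Elements of C(B) are represented extensionally (they take the value undefined outside B),
   so that HOL equality of two elements coincides with equality of functions on B. *)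
definition cspace :: "'a::topological_space set \<Rightarrow> ('a \<Rightarrow> real) set" where
  "cspace B = {x \<in> extensional B. continuous_on B x}"

definition chebyshev_norm :: "'a set \<Rightarrow> ('a \<Rightarrow> real) \<Rightarrow> real" where
  "chebyshev_norm B x = (SUP t\<in>B. \<bar>x t\<bar>)"

(* The iterated integrals from g_1 to t_1, ..., g_m to t_m are read as the integral over
   the m-dimensional box cbox g t. *)
definition vf_rhs ::
  "(real ^ 'm \<Rightarrow> real \<Rightarrow> real \<Rightarrow> real \<Rightarrow> real) \<Rightarrow>
   (real ^ 'm \<Rightarrow> real ^ 'm \<Rightarrow> real \<Rightarrow> real) \<Rightarrow> (real ^ 'm \<Rightarrow> real ^ 'm \<Rightarrow> real \<Rightarrow> real) \<Rightarrow>
   real ^ 'm \<Rightarrow> real ^ 'm \<Rightarrow> (real ^ 'm \<Rightarrow> real) \<Rightarrow> real ^ 'm \<Rightarrow> real" where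
  "vf_rhs F K H g h x t =
     F t (x t) (integral (cbox g t) (\<lambda>s. K t s (x s))) (integral (cbox g h) (\<lambda>s. H t s (x s)))"

definition vf_solution ::
  "(real ^ 'm \<Rightarrow> real \<Rightarrow> real \<Rightarrow> real \<Rightarrow> real) \<Rightarrow>
   (real ^ 'm \<Rightarrow> real ^ 'm \<Rightarrow> real \<Rightarrow> real) \<Rightarrow> (real ^ 'm \<Rightarrow> real ^ 'm \<Rightarrow> real \<Rightarrow> real) \<Rightarrow>
   real ^ 'm \<Rightarrow> real ^ 'm \<Rightarrow> (real ^ 'm \<Rightarrow> real) \<Rightarrow> bool" where
  "vf_solution F K H g h x \<longleftrightarrow> (\<forall>t\<in>cbox g h. x t = vf_rhs F K H g h x t)"

definition vf_operator ::
  "(real ^ 'm \<Rightarrow> real \<Rightarrow> real \<Rightarrow> real \<Rightarrow> real) \<Rightarrow>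
   (real ^ 'm \<Rightarrow> real ^ 'm \<Rightarrow> real \<Rightarrow> real) \<Rightarrow> (real ^ 'm \<Rightarrow> real ^ 'm \<Rightarrow> real \<Rightarrow> real) \<Rightarrow>
   real ^ 'm \<Rightarrow> real ^ 'm \<Rightarrow> (real ^ 'm \<Rightarrow> real) \<Rightarrow> (real ^ 'm \<Rightarrow> real)" where
  "vf_operator F K H g h c = (\<lambda>t\<in>cbox g h. vf_rhs F K H g h c t)"

(* Only the terms with index n >= 1 are constrained; index 0 is irrelevant. *)
definition iteration_scheme ::
  "'a set \<Rightarrow> (('a \<Rightarrow> real) \<Rightarrow> ('a \<Rightarrow> real)) \<Rightarrow> (nat \<Rightarrow> real) \<Rightarrow>
   (nat \<Rightarrow> 'a \<Rightarrow> real) \<Rightarrow> (nat \<Rightarrow> 'a \<Rightarrow> real) \<Rightarrow> (nat \<Rightarrow> 'a \<Rightarrow> real) \<Rightarrow> bool" where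
  "iteration_scheme B A \<delta> c a b \<longleftrightarrow>
     (\<forall>n\<ge>1. a n = A (c n) \<and>
             b n = (\<lambda>t\<in>B. (1 - \<delta> n) * a n t + \<delta> n * A (a n) t) \<and>
             c (n + 1) = A (b n))"

end

theory Submission
  imports Defs
begin

text \<open>
  The operator \<open>A\<close> is a contraction of the complete space \<open>C(B)\<close>. Its constant is
  \<open>q = \<alpha> + (\<beta> L\<^sub>K + \<gamma> L\<^sub>H) vol B\<close>, where \<open>vol B\<close> is the product of the edge lengths. The argument
  is as follows: if \<open>x\<close> and \<open>y\<close> are within \<open>M\<close> of each other on \<open>B\<close>, then the Volterra and the
  Fredholm integrands differ by at most \<open>L\<^sub>K M\<close> and \<open>L\<^sub>H M\<close>, both domains of integration
  lie in \<open>B\<close>, and the Lipschitz bound on \<open>F\<close> adds up the three contributions to \<open>q M\<close>.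
  Solutions of the integral equation are the fixed points of \<open>A\<close>, so Banach's theorem
  (\<open>contraction_has_unique_fixpoint\<close>) yields existence and uniqueness of \<open>p\<close>.

  The iteration applies \<open>A\<close> to \<open>b\<^sub>n\<close>, a convex combination of \<open>A c\<^sub>n\<close> and \<open>A (A c\<^sub>n)\<close>.
  Since \<open>A\<close> fixes \<open>p\<close> and never increases the distance to it, \<open>b\<^sub>n\<close> is at most as far from \<open>p\<close> as \<open>c\<^sub>n\<close>,
  and the outer application of \<open>A\<close> gains a factor \<open>q\<close> at every step. Convergence to \<open>p\<close> is
  therefore geometric (\<open>iteration_scheme_converges\<close>).

  The analytic point is that \<open>A\<close> maps \<open>C(B)\<close> to itself. For the Volterra term the domain
  of integration \<open>cbox g t\<close> varies together with the integrand
  (\<open>continuous_on_variable_box_integral\<close>).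
\<close>

section \<open>The Chebyshev norm on continuous functions\<close>

lemma abs_le_chebyshev_norm:
  assumes "compact B" "continuous_on B x" "t \<in> B"
  shows "\<bar>x t\<bar> \<le> chebyshev_norm B x"
proof -
  have "bdd_above ((\<lambda>t. \<bar>x t\<bar>) ` B)"
    by (intro bounded_imp_bdd_above compact_imp_bounded compact_continuous_image
        continuous_intros assms)
  with assms(3) show ?thesis
    unfolding chebyshev_norm_def by (rule cSUP_upper)
qed

lemma chebyshev_norm_le:
  assumes "B \<noteq> {}" "\<And>t. t \<in> B \<Longrightarrow> \<bar>x t\<bar> \<le> M"
  shows "chebyshev_norm B x \<le> M"
  unfolding chebyshev_norm_def using assms by (rule cSUP_least)

lemma chebyshev_norm_nonneg:
  assumes "compact B" "B \<noteq> {}" "continuous_on B x"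
  shows "0 \<le> chebyshev_norm B x"
proof -
  obtain t where "t \<in> B" using assms(2) by blast
  from abs_le_chebyshev_norm[OF assms(1,3) this] show ?thesis by simp
qed

lemma cspaceD: "x \<in> cspace B \<Longrightarrow> continuous_on B x"
  by (simp add: cspace_def)

lemma restrict_in_cspace: "(\<lambda>t\<in>B. x t) \<in> cspace B" if "continuous_on B x"
  using that by (simp add: cspace_def cong: continuous_on_cong)

text \<open>
  This identification and the next one make completeness of \<open>C(B)\<close> and the abstract
  fixed point theorem for metric spaces applicable. Both sides consist of extensional
  functions, and compactness of \<open>B\<close> supplies the boundedness that \<open>cfunspace\<close> asks for.
\<close>

lemma cspace_eq_mspace_cfunspace:
  assumes "compact B"
  shows "cspace B = mspace (cfunspace (top_of_set B) euclidean_metric)"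
  using assms
  by (subst compactin_mspace_cfunspace) (auto simp: cspace_def compactin_subtopology)

lemma chebyshev_norm_diff_eq_mdist:
  assumes B: "compact B" "B \<noteq> {}" and xy: "x \<in> cspace B" "y \<in> cspace B"
  shows "chebyshev_norm B (\<lambda>t. x t - y t) = mdist (cfunspace (top_of_set B) euclidean_metric) x y"
proof (rule antisym)
  have diff: "continuous_on B (\<lambda>t. x t - y t)"
    by (intro continuous_intros cspaceD xy)
  note mem = xy[unfolded cspace_eq_mspace_cfunspace[OF B(1)]]
  show "chebyshev_norm B (\<lambda>t. x t - y t) \<le> mdist (cfunspace (top_of_set B) euclidean_metric) x y"
    using mdist_cfunspace_imp_mdist_le[OF mem order_refl]
    by (intro chebyshev_norm_le[OF B(2)]) (simp add: dist_real_def)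
  show "mdist (cfunspace (top_of_set B) euclidean_metric) x y \<le> chebyshev_norm B (\<lambda>t. x t - y t)"
    using abs_le_chebyshev_norm[OF B(1) diff] B(2)
    by (subst cfunspace_mdist_le[OF mem]) (auto simp: dist_real_def)
qed

section \<open>Contractions and the iteration scheme\<close>

lemma contraction_has_unique_fixpoint:
  assumes B: "compact B" "B \<noteq> {}" and A: "A \<in> cspace B \<rightarrow> cspace B" and "q < 1"
    and contr: "\<And>x y. x \<in> cspace B \<Longrightarrow> y \<in> cspace B \<Longrightarrow>
       chebyshev_norm B (\<lambda>t. A x t - A y t) \<le> q * chebyshev_norm B (\<lambda>t. x t - y t)"
  shows "\<exists>!p. p \<in> cspace B \<and> A p = p"
proof -
  let ?C = "cfunspace (top_of_set B) (euclidean_metric :: real metric)"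
  have eq: "cspace B = mspace ?C" by (rule cspace_eq_mspace_cfunspace[OF B(1)])
  interpret C: Metric_space "mspace ?C" "mdist ?C" by (rule Metric_space_mspace_mdist)
  have complete: "C.mcomplete"
    using Met_TC.mcomplete_cfunspace[where 'a=real and X="top_of_set B"] complete_UNIV
    by (simp add: mcomplete_of_def euclidean_metric_def Met_TC.Self_def)
  have "(\<lambda>t\<in>B. 0) \<in> cspace B" by (rule restrict_in_cspace) simp
  then have ne: "cspace B \<noteq> {}" by blast
  have A': "A \<in> mspace ?C \<rightarrow> mspace ?C" using A unfolding eq .
  have c: "mdist ?C (A x) (A y) \<le> q * mdist ?C x y" if "x \<in> mspace ?C" "y \<in> mspace ?C" for x y
  proof -
    have xy: "x \<in> cspace B" "y \<in> cspace B" unfolding eq by (rule that)+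
    then have "A x \<in> cspace B" "A y \<in> cspace B" using A by (auto simp: Pi_iff)
    with contr[OF xy] xy show ?thesis by (simp only: chebyshev_norm_diff_eq_mdist[OF B])
  qed
  obtain p where p: "p \<in> mspace ?C" "A p = p"
    by (rule C.Banach_fixedpoint_thm[OF complete ne[unfolded eq] A' \<open>q < 1\<close> c])
  show ?thesis unfolding eq
  proof (rule ex1I[of _ p])
    show "r = p" if "r \<in> mspace ?C \<and> A r = r" for r
      by (rule C.contraction_imp_unique_fixpoint[OF _ p(2) A' \<open>q < 1\<close> c _ p(1)]) (use that in blast)+
  qed (use p in blast)
qed

text \<open>
  The closed ball around \<open>p\<close> through \<open>c n\<close> is convex and contains both \<open>A (c n)\<close> and
  \<open>A (A (c n))\<close>, hence also \<open>b n\<close>. Applying \<open>A\<close> once more shrinks the distance to \<open>p\<close> by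
  a factor of at most \<open>q\<close> per step.
\<close>

lemma iteration_scheme_converges:
  assumes B: "compact B" "B \<noteq> {}" and A: "A \<in> cspace B \<rightarrow> cspace B" and q: "0 \<le> q" "q < 1"
    and contr: "\<And>x y. x \<in> cspace B \<Longrightarrow> y \<in> cspace B \<Longrightarrow>
       chebyshev_norm B (\<lambda>t. A x t - A y t) \<le> q * chebyshev_norm B (\<lambda>t. x t - y t)"
    and p: "p \<in> cspace B" "A p = p"
    and \<delta>: "\<And>n. n \<ge> 1 \<Longrightarrow> \<delta> n \<in> {0..1}"
    and c: "c 1 \<in> cspace B" "iteration_scheme B A \<delta> c a b"
  shows "\<And>n. n \<ge> 1 \<Longrightarrow> c n \<in> cspace B"
    and "(\<lambda>n. chebyshev_norm B (\<lambda>t. c n t - p t)) \<longlonglongrightarrow> 0"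
proof -
  let ?N = "\<lambda>x. chebyshev_norm B (\<lambda>t. x t - p t)"
  have nonneg: "0 \<le> ?N x" if "x \<in> cspace B" for x
    by (intro chebyshev_norm_nonneg B continuous_intros cspaceD that p)
  have toward: "?N (A x) \<le> q * ?N x" if "x \<in> cspace B" for x
    using contr[OF that p(1)] p(2) by simp
  have step: "c (n + 1) \<in> cspace B \<and> ?N (c (n + 1)) \<le> q * ?N (c n)"
    if n: "n \<ge> 1" and cn: "c n \<in> cspace B" for n
  proof -
    have a: "a n = A (c n)" and b: "b n = (\<lambda>t\<in>B. (1 - \<delta> n) * a n t + \<delta> n * A (a n) t)"
      and c': "c (n + 1) = A (b n)"
      using c(2) n unfolding iteration_scheme_def by blast+
    have an: "a n \<in> cspace B" "A (a n) \<in> cspace B" using a cn A by auto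
    have bn: "b n \<in> cspace B"
      unfolding b by (intro restrict_in_cspace continuous_intros an[THEN cspaceD])
    have Na: "?N (a n) \<le> ?N (c n)"
      using toward[OF cn] mult_right_mono[of q 1 "?N (c n)"] q nonneg[OF cn] a by simp
    have NAa: "?N (A (a n)) \<le> ?N (c n)"
      using toward[OF an(1)] mult_right_mono[of q 1 "?N (a n)"] q nonneg[OF an(1)] Na by simp
    have "?N (b n) \<le> ?N (c n)"
    proof (rule chebyshev_norm_le[OF B(2)])
      fix t assume t: "t \<in> B"
      have "\<bar>a n t - p t\<bar> \<le> ?N (c n)" "\<bar>A (a n) t - p t\<bar> \<le> ?N (c n)"
        using abs_le_chebyshev_norm[OF B(1) _ t, of "\<lambda>t. a n t - p t"]
          abs_le_chebyshev_norm[OF B(1) _ t, of "\<lambda>t. A (a n) t - p t"] Na NAa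
          an[THEN cspaceD] p(1)[THEN cspaceD]
        by (force intro!: continuous_intros)+
      moreover have "b n t - p t = (1 - \<delta> n) * (a n t - p t) + \<delta> n * (A (a n) t - p t)"
        using t by (simp add: b algebra_simps)
      ultimately have "\<bar>b n t - p t\<bar> \<le> (1 - \<delta> n) * ?N (c n) + \<delta> n * ?N (c n)"
        using \<delta>[OF n]
        by (auto intro!: order_trans[OF abs_triangle_ineq] add_mono mult_left_mono simp: abs_mult)
      then show "\<bar>b n t - p t\<bar> \<le> ?N (c n)" by (simp add: algebra_simps)
    qed
    then have "?N (c (n + 1)) \<le> q * ?N (c n)"
      unfolding c' using toward[OF bn] mult_left_mono[OF _ q(1)] by (meson order_trans)
    then show ?thesis using A bn c' by auto
  qed
  have pow: "c (Suc n) \<in> cspace B \<and> ?N (c (Suc n)) \<le> q ^ n * ?N (c 1)" for n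
  proof (induction n)
    case 0
    show ?case using c(1) by simp
  next
    case (Suc n)
    then have "?N (c (Suc (Suc n))) \<le> q * ?N (c (Suc n))" "c (Suc (Suc n)) \<in> cspace B"
      using step[of "Suc n"] by simp_all
    moreover have "q * ?N (c (Suc n)) \<le> q * (q ^ n * ?N (c 1))"
      using Suc q(1) by (intro mult_left_mono) auto
    ultimately show ?case by (simp add: mult.assoc)
  qed
  show "c n \<in> cspace B" if "n \<ge> 1" for n
    using pow[of "n - 1"] that by simp
  have "(\<lambda>n. ?N (c (Suc n))) \<longlonglongrightarrow> 0"
  proof (rule real_tendsto_sandwich[OF _ _ tendsto_const])
    show "(\<lambda>n. q ^ n * ?N (c 1)) \<longlonglongrightarrow> 0"
      using q by (intro tendsto_mult_left_zero LIMSEQ_realpow_zero)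
    show "\<forall>\<^sub>F n in sequentially. 0 \<le> ?N (c (Suc n))"
      using pow nonneg by simp
    show "\<forall>\<^sub>F n in sequentially. ?N (c (Suc n)) \<le> q ^ n * ?N (c 1)"
      using pow by simp
  qed
  then show "(\<lambda>n. ?N (c n)) \<longlonglongrightarrow> 0" by (rule LIMSEQ_imp_Suc)
qed

section \<open>Continuity and comparison of box integrals\<close>

lemma continuous_on_slice:
  assumes "continuous_on (S \<times> T) (\<lambda>(t, s). f t s)" "t \<in> S"
  shows "continuous_on T (f t)"
proof -
  have "continuous_on T (\<lambda>s. (t, s))" by (intro continuous_intros)
  from continuous_on_compose2[OF assms(1) this] assms(2) show ?thesis
    by (simp add: image_subset_iff)
qed

lemma cbox_subset_cbox_upper:
  fixes u :: "'a::euclidean_space"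
  assumes "u \<in> cbox a b"
  shows "cbox a u \<subseteq> cbox a b"
  using assms by (simp add: subset_box mem_box)

text \<open>
  The bound uses the volume of a fixed surrounding box. A Volterra integral over
  \<open>cbox g t\<close> is thereby controlled by a constant that does not depend on \<open>t\<close>.
\<close>

lemma norm_integral_diff_le_on_subbox:
  fixes f f' :: "'a::euclidean_space \<Rightarrow> 'b::banach"
  assumes sub: "cbox a b \<subseteq> cbox g h" and "0 \<le> C"
    and int: "f integrable_on cbox a b" "f' integrable_on cbox a b"
    and C: "\<And>s. s \<in> cbox a b \<Longrightarrow> norm (f s - f' s) \<le> C"
  shows "norm (integral (cbox a b) f - integral (cbox a b) f') \<le> C * measure lborel (cbox g h)"
proof -
  have "((\<lambda>s. f s - f' s) has_integral integral (cbox a b) f - integral (cbox a b) f') (cbox a b)"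
    using int by (intro has_integral_diff integrable_integral)
  then have "norm (integral (cbox a b) f - integral (cbox a b) f') \<le> C * measure lborel (cbox a b)"
    using \<open>0 \<le> C\<close> C by (intro has_integral_bound)
  also have "\<dots> \<le> C * measure lborel (cbox g h)"
    using \<open>0 \<le> C\<close> sub by (intro mult_left_mono content_subset)
  finally show ?thesis .
qed

text \<open>
  Both the domain and the integrand move with \<open>t\<close>. The two effects are separated:
  replacing \<open>f u\<close> by \<open>f t\<close> costs little because \<open>f\<close> is uniformly continuous on a compact set,
  and replacing \<open>cbox a u\<close> by \<open>cbox a t\<close> costs little because the indefinite integral of
  the fixed function \<open>f t\<close> is continuous.
\<close>

lemma continuous_on_variable_box_integral:
  fixes f :: "'a::euclidean_space \<Rightarrow> 'a \<Rightarrow> 'b::euclidean_space"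
  assumes f: "continuous_on (cbox a b \<times> cbox a b) (\<lambda>(t, s). f t s)"
  shows "continuous_on (cbox a b) (\<lambda>t. integral (cbox a t) (f t))"
  unfolding continuous_on_iff
proof (intro ballI allI impI)
  fix t and e :: real
  assume t: "t \<in> cbox a b" and "e > 0"
  \<comment> \<open>The summand 1 keeps the denominator positive when the box is degenerate.\<close>
  define \<eta> where "\<eta> = e / (2 * (measure lborel (cbox a b) + 1))"
  have pos: "measure lborel (cbox a b) + 1 > 0" by (simp add: add_nonneg_pos)
  have "\<eta> > 0" and \<eta>: "\<eta> * measure lborel (cbox a b) < e / 2"
    using \<open>e > 0\<close> pos by (auto simp: \<eta>_def field_simps)
  have cont: "continuous_on (cbox a b) (f t)" if "t \<in> cbox a b" for t
    by (rule continuous_on_slice[OF f that])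
  have int: "f u integrable_on cbox a v" if "u \<in> cbox a b" "v \<in> cbox a b" for u v
    by (rule integrable_continuous
        continuous_on_subset[OF cont[OF that(1)] cbox_subset_cbox_upper[OF that(2)]])+
  have "uniformly_continuous_on (cbox a b \<times> cbox a b) (\<lambda>(t, s). f t s)"
    by (intro compact_uniformly_continuous f compact_Times compact_cbox)
  then obtain d1 where "d1 > 0" and d1: "\<And>u s. u \<in> cbox a b \<Longrightarrow> s \<in> cbox a b \<Longrightarrow>
      dist u t < d1 \<Longrightarrow> dist (f u s) (f t s) < \<eta>"
    using \<open>\<eta> > 0\<close> t unfolding uniformly_continuous_on_def
    by (force simp: dist_Pair_Pair)
  have a: "a \<in> cbox a b" using t by (auto simp: mem_box intro: order_trans)
  have "f t integrable_on cbox a b" by (rule integrable_continuous[OF cont[OF t]])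
  moreover have "e / 2 > 0" using \<open>e > 0\<close> by simp
  ultimately obtain d2 where "d2 > 0" and d2: "\<And>u v. u \<in> cbox a b \<Longrightarrow> v \<in> cbox a b \<Longrightarrow>
      norm (u - a) \<le> d2 \<Longrightarrow> norm (v - t) \<le> d2 \<Longrightarrow>
      norm (integral (cbox u v) (f t) - integral (cbox a t) (f t)) < e / 2"
    using indefinite_integral_continuous[OF _ a t] by blast
  show "\<exists>d>0. \<forall>u\<in>cbox a b. dist u t < d \<longrightarrow>
      dist (integral (cbox a u) (f u)) (integral (cbox a t) (f t)) < e"
  proof (intro exI[of _ "min d1 d2"] conjI ballI impI)
    show "min d1 d2 > 0" using \<open>d1 > 0\<close> \<open>d2 > 0\<close> by simp
    fix u assume u: "u \<in> cbox a b" and ut: "dist u t < min d1 d2"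
    have "norm (integral (cbox a u) (f u) - integral (cbox a u) (f t)) \<le> \<eta> * measure lborel (cbox a b)"
    proof (rule norm_integral_diff_le_on_subbox[OF cbox_subset_cbox_upper[OF u] _ int[OF u u] int[OF t u]])
      show "norm (f u s - f t s) \<le> \<eta>" if "s \<in> cbox a u" for s
        using d1[OF u, of s] cbox_subset_cbox_upper[OF u] that ut by (auto simp: dist_norm less_imp_le)
    qed (use \<open>\<eta> > 0\<close> in simp)
    then have "dist (integral (cbox a u) (f u)) (integral (cbox a u) (f t)) < e / 2"
      using \<eta> by (simp add: dist_norm)
    moreover have "dist (integral (cbox a u) (f t)) (integral (cbox a t) (f t)) < e / 2"
      using d2[OF a u] ut \<open>d2 > 0\<close> by (simp add: dist_norm)
    ultimately show "dist (integral (cbox a u) (f u)) (integral (cbox a t) (f t)) < e"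
      by (metis dist_commute dist_triangle_half_r)
  qed
qed

lemma continuous_on_kernel_compose:
  assumes K: "continuous_on (S \<times> T \<times> UNIV) (\<lambda>(t, s, u). K t s u)" and x: "continuous_on T x"
  shows "continuous_on (S \<times> T) (\<lambda>(t, s). K t s (x s))"
proof -
  have "continuous_on (S \<times> T) (\<lambda>z. (fst z, snd z, x (snd z)))"
    by (intro continuous_intros continuous_on_compose2[OF x]) auto
  from continuous_on_compose2[OF K this] show ?thesis by (simp add: case_prod_beta image_subset_iff)
qed

section \<open>The Volterra-Fredholm equation\<close>

theorem theorem5p2:
  fixes g h :: "real ^ 'm"
    and F :: "real ^ 'm \<Rightarrow> real \<Rightarrow> real \<Rightarrow> real \<Rightarrow> real"
    and K H :: "real ^ 'm \<Rightarrow> real ^ 'm \<Rightarrow> real \<Rightarrow> real"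
    and \<alpha> \<beta> \<gamma> L\<^sub>K L\<^sub>H :: real
    and \<delta> :: "nat \<Rightarrow> real"
  defines "B \<equiv> cbox g h"
  defines "G \<equiv> cspace B"
  defines "A \<equiv> vf_operator F K H g h"
  assumes box: "\<forall>i. g $ i \<le> h $ i"
    and A1: "continuous_on (B \<times> B \<times> UNIV) (\<lambda>(t, s, u). K t s u)"
            "continuous_on (B \<times> B \<times> UNIV) (\<lambda>(t, s, u). H t s u)"
    and A2: "continuous_on (B \<times> UNIV \<times> UNIV \<times> UNIV) (\<lambda>(t, u, v, w). F t u v w)"
    and A3: "\<alpha> \<ge> 0" "\<beta> \<ge> 0" "\<gamma> \<ge> 0"
            "\<forall>t\<in>B. \<forall>u1 u2 v1 v2 w1 w2.
               \<bar>F t u1 v1 w1 - F t u2 v2 w2\<bar> \<le> \<alpha> * \<bar>u1 - u2\<bar> + \<beta> * \<bar>v1 - v2\<bar> + \<gamma> * \<bar>w1 - w2\<bar>"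
    and A4: "L\<^sub>K \<ge> 0" "L\<^sub>H \<ge> 0"
            "\<forall>t\<in>B. \<forall>s\<in>B. \<forall>u v. \<bar>K t s u - K t s v\<bar> \<le> L\<^sub>K * \<bar>u - v\<bar>"
            "\<forall>t\<in>B. \<forall>s\<in>B. \<forall>u v. \<bar>H t s u - H t s v\<bar> \<le> L\<^sub>H * \<bar>u - v\<bar>"
    and A5: "\<alpha> + (\<beta> * L\<^sub>K + \<gamma> * L\<^sub>H) * (\<Prod>i\<in>UNIV. h $ i - g $ i) < 1"
    and delta: "\<forall>n\<ge>1. \<delta> n \<in> {0..1}"
               "filterlim (\<lambda>N. \<Sum>n=1..N. \<delta> n) at_top sequentially"
  shows "A \<in> G \<rightarrow> G \<and>
    (\<exists>p\<in>G. vf_solution F K H g h p \<and>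
       (\<forall>q\<in>G. vf_solution F K H g h q \<longrightarrow> q = p) \<and>
       (\<forall>c a b. c 1 \<in> G \<longrightarrow> iteration_scheme B A \<delta> c a b \<longrightarrow>
          (\<forall>n\<ge>1. c n \<in> G) \<and>
          (\<lambda>n. chebyshev_norm B (\<lambda>t. c n t - p t)) \<longlonglongrightarrow> 0))"
proof -
  let ?q = "\<alpha> + (\<beta> * L\<^sub>K + \<gamma> * L\<^sub>H) * measure lborel B"
  have B: "compact B" "B \<noteq> {}"
    using box by (auto simp: B_def interval_ne_empty_cart)
  have vol: "measure lborel B = (\<Prod>i\<in>UNIV. h $ i - g $ i)"
    using B(2) unfolding B_def by (rule content_cbox_cart)
  have q: "0 \<le> ?q" "?q < 1"
    using A3(1-3) A4(1,2) A5 by (simp_all add: vol[symmetric])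
  have sub: "cbox g t \<subseteq> B" if "t \<in> B" for t
    using that unfolding B_def by (rule cbox_subset_cbox_upper)
  have kernels: "continuous_on (B \<times> B) (\<lambda>(t, s). K t s (x s))"
    "continuous_on (B \<times> B) (\<lambda>(t, s). H t s (x s))" if "x \<in> G" for x
    using continuous_on_kernel_compose[OF A1(1)] continuous_on_kernel_compose[OF A1(2)] that
    by (auto simp: G_def dest: cspaceD)
  have rhs: "continuous_on B (vf_rhs F K H g h x)" if x: "x \<in> G" for x
  proof -
    have "continuous_on B (\<lambda>t. (t, x t, integral (cbox g t) (\<lambda>s. K t s (x s)),
        integral (cbox g h) (\<lambda>s. H t s (x s))))"
      using continuous_on_variable_box_integral[OF kernels(1)[OF x, unfolded B_def]]
        integral_continuous_on_param[OF kernels(2)[OF x, unfolded B_def]] cspaceD[OF x[unfolded G_def]]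
      unfolding B_def by (intro continuous_on_Pair continuous_on_id)
    from continuous_on_compose2[OF A2 this] show ?thesis
      by (simp add: vf_rhs_def[abs_def] image_subset_iff)
  qed
  have A: "A \<in> G \<rightarrow> G"
    using restrict_in_cspace[OF rhs] unfolding A_def vf_operator_def G_def B_def by blast
  have contr: "chebyshev_norm B (\<lambda>t. A x t - A y t) \<le> ?q * chebyshev_norm B (\<lambda>t. x t - y t)"
    if x: "x \<in> G" and y: "y \<in> G" for x y
  proof (rule chebyshev_norm_le[OF B(2)])
    fix t assume t: "t \<in> B"
    let ?M = "chebyshev_norm B (\<lambda>t. x t - y t)"
    have diff: "continuous_on B (\<lambda>t. x t - y t)"
      using x y unfolding G_def by (intro continuous_intros cspaceD)
    have M: "\<bar>x s - y s\<bar> \<le> ?M" if "s \<in> B" for s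
      using abs_le_chebyshev_norm[OF B(1) diff that] .
    have M0: "0 \<le> ?M" by (rule chebyshev_norm_nonneg[OF B diff])
    have int: "(\<lambda>s. K t s (z s)) integrable_on cbox g t" "(\<lambda>s. H t s (z s)) integrable_on cbox g h"
      if "z \<in> G" for z
    proof -
      have "continuous_on B (\<lambda>s. K t s (z s))" "continuous_on B (\<lambda>s. H t s (z s))"
        using kernels[OF that] t by (auto dest: continuous_on_slice)
      then show "(\<lambda>s. K t s (z s)) integrable_on cbox g t"
        "(\<lambda>s. H t s (z s)) integrable_on cbox g h"
        using continuous_on_subset[OF _ sub[OF t]] by (auto simp: B_def intro!: integrable_continuous)
    qed
    let ?IK = "\<lambda>z. integral (cbox g t) (\<lambda>s. K t s (z s))"
    let ?IH = "\<lambda>z. integral (cbox g h) (\<lambda>s. H t s (z s))"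
    have IK: "\<bar>?IK x - ?IK y\<bar> \<le> L\<^sub>K * ?M * measure lborel B"
      unfolding B_def real_norm_def[symmetric]
    proof (rule norm_integral_diff_le_on_subbox[OF sub[OF t, unfolded B_def] _ int(1)[OF x] int(1)[OF y]])
      show "norm (K t s (x s) - K t s (y s)) \<le> L\<^sub>K * chebyshev_norm (cbox g h) (\<lambda>t. x t - y t)"
        if "s \<in> cbox g t" for s
      proof -
        have s: "s \<in> B" using that sub[OF t] by blast
        have "\<bar>K t s (x s) - K t s (y s)\<bar> \<le> L\<^sub>K * \<bar>x s - y s\<bar>" using A4(3) t s by blast
        also have "\<dots> \<le> L\<^sub>K * ?M" using M[OF s] A4(1) by (rule mult_left_mono)
        finally show ?thesis by (simp add: B_def)
      qed
    qed (use A4(1) M0 in \<open>simp add: B_def\<close>)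
    have IH: "\<bar>?IH x - ?IH y\<bar> \<le> L\<^sub>H * ?M * measure lborel B"
      unfolding B_def real_norm_def[symmetric]
    proof (rule norm_integral_diff_le_on_subbox[OF order_refl _ int(2)[OF x] int(2)[OF y]])
      show "norm (H t s (x s) - H t s (y s)) \<le> L\<^sub>H * chebyshev_norm (cbox g h) (\<lambda>t. x t - y t)"
        if "s \<in> cbox g h" for s
      proof -
        have s: "s \<in> B" using that by (simp add: B_def)
        have "\<bar>H t s (x s) - H t s (y s)\<bar> \<le> L\<^sub>H * \<bar>x s - y s\<bar>" using A4(4) t s by blast
        also have "\<dots> \<le> L\<^sub>H * ?M" using M[OF s] A4(2) by (rule mult_left_mono)
        finally show ?thesis by (simp add: B_def)
      qed
    qed (use A4(2) M0 in \<open>simp add: B_def\<close>)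
    have "\<bar>A x t - A y t\<bar> \<le> \<alpha> * \<bar>x t - y t\<bar> + \<beta> * \<bar>?IK x - ?IK y\<bar> + \<gamma> * \<bar>?IH x - ?IH y\<bar>"
      using A3(4) t by (simp add: A_def vf_operator_def vf_rhs_def B_def)
    also have "\<dots> \<le> \<alpha> * ?M + \<beta> * (L\<^sub>K * ?M * measure lborel B) + \<gamma> * (L\<^sub>H * ?M * measure lborel B)"
      using M[OF t] IK IH A3 by (intro add_mono mult_left_mono)
    also have "\<dots> = ?q * ?M" by (simp add: algebra_simps)
    finally show "\<bar>A x t - A y t\<bar> \<le> ?q * ?M" .
  qed
  have solution: "vf_solution F K H g h x \<longleftrightarrow> A x = x" if "x \<in> G" for x
  proof -
    \<comment> \<open>Off \<open>B\<close> both sides have the default value of extensional functions.\<close>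
    have "A x = x \<longleftrightarrow> (\<forall>t\<in>B. A x t = x t)"
      using that A by (auto simp: G_def cspace_def intro: extensionalityI)
    then show ?thesis
      by (auto simp: vf_solution_def A_def vf_operator_def B_def)
  qed
  obtain p where p: "p \<in> G" "A p = p" and unique: "\<And>r. r \<in> G \<Longrightarrow> A r = r \<Longrightarrow> r = p"
    using contraction_has_unique_fixpoint[OF B A[unfolded G_def] q(2) contr[unfolded G_def]]
    unfolding G_def by blast
  have "(\<forall>n\<ge>1. c n \<in> G) \<and> (\<lambda>n. chebyshev_norm B (\<lambda>t. c n t - p t)) \<longlonglongrightarrow> 0"
    if "c 1 \<in> G" "iteration_scheme B A \<delta> c a b" for c a b
  proof -
    have \<delta>: "\<delta> n \<in> {0..1}" if "n \<ge> 1" for n using delta(1) that by blast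
    note conv = iteration_scheme_converges[OF B A[unfolded G_def] q contr[unfolded G_def]
        p[unfolded G_def] \<delta> that[unfolded G_def]]
    show ?thesis using conv unfolding G_def by blast
  qed
  with A p unique solution show ?thesis by blast
qed

end
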